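(* Let $n\in\mathbb{N}$, let $L=\{l_1,\dots,l_k\}\subseteq[n]$ with $l_1<l_2<\cdots<l_k$, and let $\alpha$ be sampled uniformly at random from the weakly increasing parking functions of length $n$. Let $L_\alpha\subseteq[n]$ be the set of lucky cars at the end of the parking process with preference list $\alpha$. Then $$\Pr[L_\alpha=L]=\begin{cases}0 & \text{if }1\notin L,\\[1mm] \dfrac{\prod_{j=1}^{k}C_{x_j}}{C_n} & \text{if }1\in L,\end{cases}$$ where $C_m$ is the $m$th Catalan number, $x_j=l_{j+1}-l_j-1$ for $1\le j<k$, and $x_k=n-l_k$.
   Context: $[n]=\{1,\dots,n\}$ and $C_m=\frac1{m+1}\binom{2m}{m}$. A weakly increasing parking function of length $n$ is a list $\alpha=(\alpha_1,\dots,\alpha_n)\in[n]^n$ with $\alpha_i\le i$ for all $i$ and $\alpha_1\le\cdots\le\alpha_n$. Classical parking protocol: cars $1,\dots,n$ arrive in order; car $i$ parks in spot $\alpha_i$ if it is unoccupied, otherwise in the first unoccupied spot to the right of $\alpha_i$. A car is lucky if it parks in its preferred spot $\alpha_i$. *)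

theory Defs
  imports "HOL-Probability.Probability_Mass_Function"
begin

definition catalan :: "nat \<Rightarrow> real" where
  "catalan m = 1 / (real m + 1) * real ((2 * m) choose m)"

text \<open>Cars and spots are numbered from 1, whereas list positions are numbered from 0.\<close>

definition pref :: "nat list \<Rightarrow> nat \<Rightarrow> nat" where
  "pref \<alpha> i = \<alpha> ! (i - 1)"

definition weakly_increasing_pfs :: "nat \<Rightarrow> nat list set" where
  "weakly_increasing_pfs n =
     {\<alpha>. length \<alpha> = n \<and> (\<forall>i\<in>{1..n}. pref \<alpha> i \<in> {1..n} \<and> pref \<alpha> i \<le> i) \<and> sorted \<alpha>}"

text \<open>The spot taken, on a street with spots \<open>1, \<dots>, n\<close> of which those in \<open>Occ\<close> are occupied, by a
  car preferring spot \<open>a\<close>. The value \<^term>\<open>None\<close> means that the car leaves the street without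
  parking; this never happens for a parking function, but keeps the protocol total.\<close>

definition choose_spot :: "nat \<Rightarrow> nat set \<Rightarrow> nat \<Rightarrow> nat option" where
  "choose_spot n Occ a =
     (if a \<in> {1..n} - Occ then Some a
      else if \<exists>s\<in>{1..n} - Occ. a < s then Some (LEAST s. s \<in> {1..n} - Occ \<and> a < s)
      else None)"

text \<open>The set of spots occupied once cars \<open>1, \<dots>, i\<close> have arrived. As there are as many spots as
  cars, the street has \<^term>\<open>length \<alpha>\<close> spots.\<close>

primrec occupied :: "nat list \<Rightarrow> nat \<Rightarrow> nat set" where
  "occupied \<alpha> 0 = {}"
| "occupied \<alpha> (Suc i) =
     occupied \<alpha> i \<union> set_option (choose_spot (length \<alpha>) (occupied \<alpha> i) (pref \<alpha> (Suc i)))"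

definition parked_spot :: "nat list \<Rightarrow> nat \<Rightarrow> nat option" where
  "parked_spot \<alpha> i = choose_spot (length \<alpha>) (occupied \<alpha> (i - 1)) (pref \<alpha> i)"

definition lucky_cars :: "nat list \<Rightarrow> nat set" where
  "lucky_cars \<alpha> = {i \<in> {1..length \<alpha>}. parked_spot \<alpha> i = Some (pref \<alpha> i)}"

end

theory Submission
  imports Defs
begin

text \<open>
  Along a weakly increasing parking function the occupied spots always form an initial segment:
  when car \<open>i\<close> arrives, the spots \<open>1, \<dots>, i - 1\<close> are taken and its preference is at most \<open>i\<close>, so it
  parks in spot \<open>i\<close>. Hence the lucky cars are exactly the fixed points of \<open>i \<mapsto> \<alpha>\<^sub>i\<close>, and the problem
  is to count the weakly increasing parking functions with a prescribed set of fixed points.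

  Cut such an \<open>\<alpha>\<close> at its last fixed point \<open>m\<close>. What precedes \<open>m\<close> is a weakly increasing parking
  function of length \<open>m - 1\<close> that has all the other fixed points. What follows has
  \<open>m \<le> \<alpha>\<^sub>m\<^sub>+\<^sub>t < m + t\<close>, the lower bound by monotonicity and the upper one because there are no further
  fixed points, so that lowering the values by \<open>m - 1\<close> leaves an arbitrary weakly increasing parking
  function of length \<open>n - m\<close>. This is the bijection \<open>bij_betw_cut_at_last_lucky\<close>; iterating it over
  the elements of \<open>L\<close> from the largest to the smallest yields the product of the numbers of weakly
  increasing parking functions of lengths \<open>x\<^sub>k, \<dots>, x\<^sub>1\<close>. The process ends at the fixed point \<open>1\<close>,
  which is always present because \<open>\<alpha>\<^sub>1 = 1\<close>.

  That there are \<open>C\<^sub>n\<close> weakly increasing parking functions of length \<open>n\<close> follows from the refined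
  count by an upper bound on the values, which obeys the recurrence of the ballot numbers
  (\<open>card_wipf_bounded\<close>).
\<close>

section \<open>Lucky cars are fixed points\<close>

lemma wipf_iff:
  "\<alpha> \<in> weakly_increasing_pfs n \<longleftrightarrow>
     length \<alpha> = n \<and> sorted \<alpha> \<and> (\<forall>i<n. 1 \<le> \<alpha> ! i \<and> \<alpha> ! i \<le> Suc i)"
proof -
  have "(\<forall>i\<in>{1..n}. P i) \<longleftrightarrow> (\<forall>i<n. P (Suc i))" for P
    unfolding image_Suc_lessThan[symmetric] by auto
  then show ?thesis
    unfolding weakly_increasing_pfs_def pref_def mem_Collect_eq by auto
qed

lemma wipf_set_subset:
  assumes "\<alpha> \<in> weakly_increasing_pfs n"
  shows "set \<alpha> \<subseteq> {1..n}"
  using assms by (fastforce simp: wipf_iff set_conv_nth)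

lemma finite_wipf: "finite (weakly_increasing_pfs n)"
proof (rule finite_subset)
  show "weakly_increasing_pfs n \<subseteq> {\<alpha>. set \<alpha> \<subseteq> {1..n} \<and> length \<alpha> = n}"
    using wipf_set_subset wipf_iff by blast
qed (simp add: finite_lists_length_eq)

lemma wipf_0: "weakly_increasing_pfs 0 = {[]}"
  by (auto simp: wipf_iff)

lemma choose_spot_initial_segment:
  assumes "1 \<le> a" "a \<le> Suc i" "i < n"
  shows "choose_spot n {1..i} a = Some (Suc i)"
proof (cases "a = Suc i")
  case True
  then show ?thesis using assms by (simp add: choose_spot_def)
next
  case False
  have "(LEAST s. s \<in> {1..n} - {1..i} \<and> a < s) = Suc i"
    using assms False by (intro Least_equality) auto
  moreover have "\<exists>s\<in>{1..n} - {1..i}. a < s"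
    using assms False by (intro bexI[of _ "Suc i"]) auto
  ultimately show ?thesis
    using assms False by (auto simp: choose_spot_def)
qed

lemma occupied_wipf:
  assumes "\<alpha> \<in> weakly_increasing_pfs n" "i \<le> n"
  shows "occupied \<alpha> i = {1..i}"
  using assms(2)
proof (induction i)
  case (Suc i)
  then have "choose_spot (length \<alpha>) (occupied \<alpha> i) (pref \<alpha> (Suc i)) = Some (Suc i)"
    using assms(1) choose_spot_initial_segment by (simp add: wipf_iff pref_def)
  then show ?case
    using Suc by (auto simp: atLeastAtMostSuc_conv)
qed simp

lemma parked_spot_wipf:
  assumes "\<alpha> \<in> weakly_increasing_pfs n" "i < n"
  shows "parked_spot \<alpha> (Suc i) = Some (Suc i)"
proof -
  have "length \<alpha> = n" "choose_spot n {1..i} (\<alpha> ! i) = Some (Suc i)"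
    using assms choose_spot_initial_segment by (simp_all add: wipf_iff)
  then show ?thesis
    using occupied_wipf[OF assms(1), of i] assms(2) by (simp add: parked_spot_def pref_def)
qed

lemma Suc_in_lucky_cars_iff:
  assumes "\<alpha> \<in> weakly_increasing_pfs n"
  shows "Suc i \<in> lucky_cars \<alpha> \<longleftrightarrow> i < n \<and> \<alpha> ! i = Suc i"
  using assms parked_spot_wipf[OF assms, of i]
  by (auto simp: lucky_cars_def pref_def wipf_iff)

lemma zero_notin_lucky_cars: "0 \<notin> lucky_cars \<alpha>"
  by (simp add: lucky_cars_def)

lemma lucky_cars_eqI:
  assumes "\<alpha> \<in> weakly_increasing_pfs n" "0 \<notin> L"
    and "\<And>i. Suc i \<in> L \<longleftrightarrow> i < n \<and> \<alpha> ! i = Suc i"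
  shows "lucky_cars \<alpha> = L"
proof (rule set_eqI)
  fix i show "i \<in> lucky_cars \<alpha> \<longleftrightarrow> i \<in> L"
    using assms zero_notin_lucky_cars by (cases i) (auto simp: Suc_in_lucky_cars_iff)
qed

lemma first_car_lucky:
  assumes "\<alpha> \<in> weakly_increasing_pfs n" "n \<ge> 1"
  shows "1 \<in> lucky_cars \<alpha>"
proof -
  have "\<alpha> ! 0 = Suc 0"
    using assms by (simp add: wipf_iff le_antisym)
  then show ?thesis
    using Suc_in_lucky_cars_iff[OF assms(1), of 0] assms(2) by simp
qed


section \<open>Cutting at the last lucky car\<close>

text \<open>Here \<open>Suc p\<close> is the last lucky car and \<open>q\<close> cars follow it. The shifted entries of \<open>\<gamma>\<close> exceed
  \<open>p\<close>, which keeps the list sorted, and each of them stays strictly below its car's number because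
  the entry \<open>Suc p\<close> delays \<open>\<gamma>\<close> by one more car than its values are raised; so no car of \<open>\<gamma>\<close> is
  lucky.\<close>

lemma wipf_join:
  assumes \<beta>: "\<beta> \<in> weakly_increasing_pfs p" and \<gamma>: "\<gamma> \<in> weakly_increasing_pfs q"
  shows "\<beta> @ Suc p # map ((+) p) \<gamma> \<in> weakly_increasing_pfs (p + Suc q)" (is "?\<alpha> \<in> _")
    and "lucky_cars (\<beta> @ Suc p # map ((+) p) \<gamma>) = insert (Suc p) (lucky_cars \<beta>)"
proof -
  have len: "length \<beta> = p" "length \<gamma> = q"
    using \<beta> \<gamma> by (simp_all add: wipf_iff)
  have low: "?\<alpha> ! i = \<beta> ! i" if "i < p" for i
    using that len by (simp add: nth_append)
  have mid: "?\<alpha> ! p = Suc p"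
    using len by (simp add: nth_append)
  have high: "p < ?\<alpha> ! i \<and> ?\<alpha> ! i \<le> i" if "p < i" "i < p + Suc q" for i
  proof -
    obtain t where i: "i = Suc (p + t)"
      using \<open>p < i\<close> less_iff_Suc_add by blast
    then have "t < q" using that by simp
    then show ?thesis
      using \<gamma> len i by (auto simp: nth_append wipf_iff)
  qed
  have "sorted ?\<alpha>"
    using \<beta> \<gamma> wipf_set_subset[OF \<beta>] wipf_set_subset[OF \<gamma>]
    by (fastforce simp: wipf_iff sorted_append sorted_map
        intro: sorted_wrt_mono_rel[of _ "(\<le>)"])
  moreover have "1 \<le> ?\<alpha> ! i \<and> ?\<alpha> ! i \<le> Suc i" if "i < p + Suc q" for i
    using that low[of i] mid high[of i] \<beta>
    by (cases i p rule: linorder_cases) (auto simp: wipf_iff)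
  ultimately show mem: "?\<alpha> \<in> weakly_increasing_pfs (p + Suc q)"
    using len by (simp add: wipf_iff)
  show "lucky_cars ?\<alpha> = insert (Suc p) (lucky_cars \<beta>)"
  proof (rule lucky_cars_eqI[OF mem])
    show "0 \<notin> insert (Suc p) (lucky_cars \<beta>)"
      by (simp add: zero_notin_lucky_cars)
  next
    fix i
    show "Suc i \<in> insert (Suc p) (lucky_cars \<beta>) \<longleftrightarrow> i < p + Suc q \<and> ?\<alpha> ! i = Suc i"
      using low[of i] mid high[of i]
      by (cases i p rule: linorder_cases) (auto simp: Suc_in_lucky_cars_iff[OF \<beta>])
  qed
qed

text \<open>Lowering the entries after the last lucky car by \<open>p\<close> inverts the join: monotonicity makes these
  entries at least \<open>Suc p\<close>, and being unlucky improves the bound on each of them by one, as a parking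
  function that starts anew after that car requires.\<close>

lemma wipf_cut:
  assumes \<alpha>: "\<alpha> \<in> weakly_increasing_pfs (p + Suc q)"
    and lucky: "lucky_cars \<alpha> = insert (Suc p) L" and L: "L \<subseteq> {1..p}"
  obtains \<beta> \<gamma> where "\<beta> \<in> weakly_increasing_pfs p" "lucky_cars \<beta> = L"
    "\<gamma> \<in> weakly_increasing_pfs q" "\<alpha> = \<beta> @ Suc p # map ((+) p) \<gamma>"
proof -
  define \<beta> where "\<beta> = take p \<alpha>"
  define \<gamma> where "\<gamma> = map (\<lambda>a. a - p) (drop (Suc p) \<alpha>)"
  have len: "length \<alpha> = p + Suc q" and srt: "sorted \<alpha>"
    using \<alpha> by (simp_all add: wipf_iff)
  have at_p: "\<alpha> ! p = Suc p"
    using lucky Suc_in_lucky_cars_iff[OF \<alpha>, of p] by simp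
  have above: "Suc p \<le> \<alpha> ! Suc (p + t) \<and> \<alpha> ! Suc (p + t) \<le> Suc (p + t)" if "t < q" for t
  proof
    show "Suc p \<le> \<alpha> ! Suc (p + t)"
      using sorted_nth_mono[OF srt, of p "Suc (p + t)"] at_p len that by simp
    have "Suc (Suc (p + t)) \<notin> lucky_cars \<alpha>"
      using lucky L by auto
    then have "\<alpha> ! Suc (p + t) \<noteq> Suc (Suc (p + t))"
      using Suc_in_lucky_cars_iff[OF \<alpha>, of "Suc (p + t)"] that by simp
    moreover have "\<alpha> ! Suc (p + t) \<le> Suc (Suc (p + t))"
      using \<alpha> that by (simp add: wipf_iff)
    ultimately show "\<alpha> ! Suc (p + t) \<le> Suc (p + t)"
      by simp
  qed
  have \<beta>_mem: "\<beta> \<in> weakly_increasing_pfs p"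
    using \<alpha> by (auto simp: \<beta>_def wipf_iff)
  have len_\<gamma>: "length \<gamma> = q"
    using len by (simp add: \<gamma>_def)
  have \<gamma>_nth: "\<gamma> ! t = \<alpha> ! Suc (p + t) - p" if "t < q" for t
    using that len by (simp add: \<gamma>_def)
  have "sorted \<gamma>"
    unfolding sorted_iff_nth_mono
  proof (intro allI impI)
    fix s t assume "s \<le> t" "t < length \<gamma>"
    then show "\<gamma> ! s \<le> \<gamma> ! t"
      using sorted_nth_mono[OF srt, of "Suc (p + s)" "Suc (p + t)"] len len_\<gamma>
      by (simp add: \<gamma>_nth diff_le_mono)
  qed
  then have \<gamma>_mem: "\<gamma> \<in> weakly_increasing_pfs q"
    using len_\<gamma> above by (fastforce simp: wipf_iff \<gamma>_nth)
  have "map ((+) p) \<gamma> = drop (Suc p) \<alpha>"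
  proof (rule nth_equalityI)
    fix t assume "t < length (map ((+) p) \<gamma>)"
    then show "map ((+) p) \<gamma> ! t = drop (Suc p) \<alpha> ! t"
      using above[of t] len len_\<gamma> by (simp add: \<gamma>_nth)
  qed (use len len_\<gamma> in simp)
  then have \<alpha>_eq: "\<alpha> = \<beta> @ Suc p # map ((+) p) \<gamma>"
    using id_take_nth_drop[of p \<alpha>] len at_p by (simp add: \<beta>_def)
  have "lucky_cars \<beta> = L"
  proof -
    have "insert (Suc p) L = insert (Suc p) (lucky_cars \<beta>)"
      using wipf_join(2)[OF \<beta>_mem \<gamma>_mem] \<alpha>_eq lucky by simp
    moreover have "Suc p \<notin> L"
      using L by auto
    moreover have "Suc p \<notin> lucky_cars \<beta>"
      by (simp add: Suc_in_lucky_cars_iff[OF \<beta>_mem])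
    ultimately show ?thesis
      by (simp add: insert_ident)
  qed
  with \<beta>_mem \<gamma>_mem \<alpha>_eq show ?thesis
    using that by blast
qed

definition wipfs_with_lucky :: "nat \<Rightarrow> nat set \<Rightarrow> nat list set" where
  "wipfs_with_lucky n L = {\<alpha> \<in> weakly_increasing_pfs n. lucky_cars \<alpha> = L}"

lemma bij_betw_cut_at_last_lucky:
  assumes L: "L \<subseteq> {1..p}"
  shows "bij_betw (\<lambda>(\<beta>, \<gamma>). \<beta> @ Suc p # map ((+) p) \<gamma>)
    (wipfs_with_lucky p L \<times> weakly_increasing_pfs q)
    (wipfs_with_lucky (p + Suc q) (insert (Suc p) L))"
    (is "bij_betw ?f ?A ?B")
proof (rule bij_betw_imageI)
  show "inj_on ?f ?A"
  proof (rule inj_onI)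
    fix u v assume "u \<in> ?A" "v \<in> ?A" and eq: "?f u = ?f v"
    moreover obtain \<beta> \<gamma> \<beta>' \<gamma>' where uv: "u = (\<beta>, \<gamma>)" "v = (\<beta>', \<gamma>')"
      by (cases u, cases v)
    ultimately have "length \<beta> = length \<beta>'"
      by (simp add: wipfs_with_lucky_def wipf_iff)
    with eq uv show "u = v"
      by (auto simp: map_injective inj_def)
  qed
  have "?f u \<in> ?B" if "u \<in> ?A" for u
    using that wipf_join by (auto simp: wipfs_with_lucky_def)
  moreover have "\<alpha> \<in> ?f ` ?A" if "\<alpha> \<in> ?B" for \<alpha>
  proof -
    have "\<alpha> \<in> weakly_increasing_pfs (p + Suc q)" "lucky_cars \<alpha> = insert (Suc p) L"
      using that by (simp_all add: wipfs_with_lucky_def)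
    then obtain \<beta> \<gamma> where "(\<beta>, \<gamma>) \<in> ?A" "\<alpha> = ?f (\<beta>, \<gamma>)"
      using wipf_cut[OF _ _ L] unfolding wipfs_with_lucky_def
      by (metis (mono_tags, lifting) SigmaI case_prod_conv mem_Collect_eq)
    then show ?thesis
      by blast
  qed
  ultimately show "?f ` ?A = ?B"
    by blast
qed

lemma card_cut_at_last_lucky:
  assumes "L \<subseteq> {1..p}"
  shows "card (wipfs_with_lucky (p + Suc q) (insert (Suc p) L)) =
    card (wipfs_with_lucky p L) * card (weakly_increasing_pfs q)"
  using bij_betw_same_card[OF bij_betw_cut_at_last_lucky[OF assms, of q]]
  by (simp add: card_cartesian_product)


section \<open>Counting weakly increasing parking functions\<close>

definition wipfs_bounded :: "nat \<Rightarrow> nat \<Rightarrow> nat list set" where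
  "wipfs_bounded n b = {\<alpha> \<in> weakly_increasing_pfs n. set \<alpha> \<subseteq> {..b}}"

lemma finite_wipfs_bounded: "finite (wipfs_bounded n b)"
  unfolding wipfs_bounded_def using finite_wipf by simp

lemma wipfs_bounded_full:
  assumes "n \<le> b"
  shows "wipfs_bounded n b = weakly_increasing_pfs n"
  using assms wipf_set_subset by (fastforce simp: wipfs_bounded_def)

lemma wipfs_bounded_1: "wipfs_bounded n 1 = {replicate n 1}"
proof -
  have "\<alpha> = replicate n 1" if "\<alpha> \<in> wipfs_bounded n 1" for \<alpha>
  proof -
    have "set \<alpha> \<subseteq> {1}" "length \<alpha> = n"
      using that wipf_set_subset[of \<alpha> n]
      by (fastforce simp: wipfs_bounded_def, simp add: wipfs_bounded_def wipf_iff)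
    then show ?thesis
      by (intro replicate_eqI) auto
  qed
  moreover have "replicate n 1 \<in> wipfs_bounded n 1"
    by (auto simp: wipfs_bounded_def wipf_iff)
  ultimately show ?thesis
    by blast
qed

lemma wipf_snoc_iff:
  "\<alpha> @ [a] \<in> weakly_increasing_pfs (Suc n) \<longleftrightarrow>
     \<alpha> \<in> weakly_increasing_pfs n \<and> set \<alpha> \<subseteq> {..a} \<and> 1 \<le> a \<and> a \<le> Suc n"
  by (auto simp: wipf_iff sorted_append nth_append less_Suc_eq)

text \<open>The last entry is the largest, so the lists that attain the bound are those that end with it.\<close>

lemma wipfs_bounded_Suc:
  assumes "b \<le> n"
  shows "wipfs_bounded (Suc n) (Suc b) =
    wipfs_bounded (Suc n) b \<union> (\<lambda>\<alpha>. \<alpha> @ [Suc b]) ` wipfs_bounded n (Suc b)"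
proof (intro equalityI subsetI)
  fix \<alpha> assume \<alpha>: "\<alpha> \<in> wipfs_bounded (Suc n) (Suc b)"
  then have "\<alpha> \<noteq> []"
    by (auto simp: wipfs_bounded_def wipf_iff)
  then obtain \<beta> a where \<alpha>_eq: "\<alpha> = \<beta> @ [a]"
    by (metis rev_exhaust)
  have mem: "\<beta> \<in> weakly_increasing_pfs n" "set \<beta> \<subseteq> {..a}" "a \<le> Suc b"
    using \<alpha> unfolding \<alpha>_eq wipfs_bounded_def by (auto simp: wipf_snoc_iff)
  show "\<alpha> \<in> wipfs_bounded (Suc n) b \<union> (\<lambda>\<alpha>. \<alpha> @ [Suc b]) ` wipfs_bounded n (Suc b)"
  proof (cases "a = Suc b")
    case True
    then show ?thesis
      using mem \<alpha>_eq by (auto simp: wipfs_bounded_def)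
  next
    case False
    then have "set \<alpha> \<subseteq> {..b}"
      using mem \<alpha>_eq by fastforce
    then show ?thesis
      using \<alpha> by (simp add: wipfs_bounded_def)
  qed
next
  fix \<alpha> assume "\<alpha> \<in> wipfs_bounded (Suc n) b \<union> (\<lambda>\<alpha>. \<alpha> @ [Suc b]) ` wipfs_bounded n (Suc b)"
  then show "\<alpha> \<in> wipfs_bounded (Suc n) (Suc b)"
    using assms by (fastforce simp: wipfs_bounded_def wipf_snoc_iff)
qed

lemma card_wipfs_bounded_Suc:
  assumes "b \<le> n"
  shows "card (wipfs_bounded (Suc n) (Suc b)) =
    card (wipfs_bounded (Suc n) b) + card (wipfs_bounded n (Suc b))"
proof -
  have "inj_on (\<lambda>\<alpha>. \<alpha> @ [Suc b]) (wipfs_bounded n (Suc b))"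
    by (simp add: inj_on_def)
  moreover have "wipfs_bounded (Suc n) b \<inter> (\<lambda>\<alpha>. \<alpha> @ [Suc b]) ` wipfs_bounded n (Suc b) = {}"
    by (auto simp: wipfs_bounded_def)
  ultimately show ?thesis
    unfolding wipfs_bounded_Suc[OF assms]
    by (simp add: card_Un_disjoint finite_wipfs_bounded card_image)
qed

text \<open>For \<open>j \<le> n + 1\<close>, the number of lattice paths from \<open>(0, 0)\<close> to \<open>(n, j)\<close> with unit steps east and
  north that never rise above the diagonal.\<close>

definition ballot :: "nat \<Rightarrow> nat \<Rightarrow> real" where
  "ballot n j = (real n - real j + 1) / (real n + 1) * real ((n + j) choose j)"

lemma ballot_0_right: "ballot n 0 = 1"
  by (simp add: ballot_def)

lemma ballot_above_diagonal: "ballot n (Suc n) = 0"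
  by (simp add: ballot_def)

lemma ballot_diagonal: "ballot n n = catalan n"
  by (simp add: ballot_def catalan_def mult_2)

text \<open>By Pascal's rule and absorption, all three binomial coefficients are rational multiples of a
  single one, and a rational identity in \<open>n\<close> and \<open>j\<close> remains.\<close>

lemma ballot_Suc_Suc: "ballot (Suc n) (Suc j) = ballot (Suc n) j + ballot n (Suc j)"
proof -
  define a where "a = real ((Suc n + j) choose j)"
  define b where "b = real ((Suc n + j) choose Suc j)"
  have "Suc j * ((Suc n + j) choose Suc j) = (Suc n + j - j) * ((Suc n + j) choose j)"
    unfolding binomial_absorption binomial_absorb_comp ..
  then have "real (Suc j * ((Suc n + j) choose Suc j)) = real (Suc n * ((Suc n + j) choose j))"
    by simp
  then have "real (Suc j) * b = real (Suc n) * a"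
    unfolding a_def b_def of_nat_mult .
  then have a: "a = (real j + 1) * b / (real n + 1)"
    by (simp add: field_simps)
  have "real ((Suc n + Suc j) choose Suc j) = a + b"
    by (simp add: a_def b_def)
  then have corner: "ballot (Suc n) (Suc j) = (real n - real j + 1) / (real n + 2) * (a + b)"
    unfolding ballot_def by simp
  have south: "ballot (Suc n) j = (real n - real j + 2) / (real n + 2) * a"
    unfolding ballot_def a_def by (simp add: add_ac)
  have west: "ballot n (Suc j) = (real n - real j) / (real n + 1) * b"
    unfolding ballot_def b_def by simp
  have "real n + 1 \<noteq> 0" "real n + 2 \<noteq> 0"
    by linarith+
  then show ?thesis
    unfolding corner south west a by (simp add: divide_simps) (simp add: algebra_simps)
qed

text \<open>The values up to \<open>j + 1\<close> correspond to the heights \<open>0, \<dots>, j\<close> of the east steps of a path. On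
  the diagonal the recurrence for paths adds a term that is zero, while raising the bound from \<open>n\<close> to
  \<open>n + 1\<close> admits no new parking function of length \<open>n\<close>.\<close>

lemma card_wipf_bounded:
  assumes "j \<le> n"
  shows "real (card (wipfs_bounded n (Suc j))) = ballot n j"
  using assms
proof (induction n arbitrary: j)
  case 0
  then show ?case
    by (simp add: wipfs_bounded_1[unfolded One_nat_def] ballot_0_right)
next
  case (Suc n)
  from Suc.prems show ?case
  proof (induction j)
    case 0
    then show ?case
      by (simp add: wipfs_bounded_1[unfolded One_nat_def] ballot_0_right)
  next
    case (Suc j)
    show ?case
    proof (cases "j = n")
      case True
      have "wipfs_bounded (Suc n) (Suc (Suc n)) = wipfs_bounded (Suc n) (Suc n)"
        by (simp add: wipfs_bounded_full)
      then show ?thesis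
        using Suc True by (simp add: ballot_Suc_Suc ballot_above_diagonal)
    next
      case False
      then have "Suc j \<le> n"
        using Suc.prems by simp
      then show ?thesis
        using Suc Suc.IH \<open>\<And>j. j \<le> n \<Longrightarrow> real (card (wipfs_bounded n (Suc j))) = ballot n j\<close>
        by (simp add: card_wipfs_bounded_Suc ballot_Suc_Suc)
    qed
  qed
qed

lemma card_wipf: "real (card (weakly_increasing_pfs n)) = catalan n"
  using card_wipf_bounded[of n n] by (simp add: wipfs_bounded_full ballot_diagonal)


section \<open>The distribution of the set of lucky cars\<close>

text \<open>Induction on the number of lucky cars, removing the last one. The gap before \<open>l (Suc k)\<close> in
  \<open>{1..n}\<close> is the final gap of the shorter parking function of length \<open>l (Suc k) - 1\<close>, which is why
  \<open>n\<close> varies.\<close>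

lemma card_wipfs_with_lucky:
  fixes k n :: nat and l :: "nat \<Rightarrow> nat"
  assumes "1 \<le> k" "strict_mono_on {1..k} l" "l 1 = 1" "l k \<le> n"
  shows "real (card (wipfs_with_lucky n (l ` {1..k}))) =
    (\<Prod>j=1..<k. catalan (l (j + 1) - l j - 1)) * catalan (n - l k)"
  using assms
proof (induction k arbitrary: n rule: nat_induct_at_least)
  case base
  then have "n = 0 + Suc (n - 1)"
    by simp
  moreover have "wipfs_with_lucky 0 {} = {[]}"
    by (auto simp: wipfs_with_lucky_def wipf_0 lucky_cars_def)
  ultimately have "card (wipfs_with_lucky n {1}) = card (weakly_increasing_pfs (n - 1))"
    using card_cut_at_last_lucky[of "{}" 0 "n - 1"] by simp
  then show ?case
    using base by (simp add: card_wipf)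
next
  case (Suc k)
  define p where "p = l (Suc k) - 1"
  define q where "q = n - l (Suc k)"
  have less: "l i < l j" if "1 \<le> i" "i < j" "j \<le> Suc k" for i j
    using strict_mono_onD[OF Suc.prems(1), of i j] that by simp
  have l_k: "l k \<le> p"
    using less[of k "Suc k"] Suc.hyps by (simp add: p_def)
  have l_Suc: "l (Suc k) = Suc p"
    using less[of k "Suc k"] Suc.hyps by (simp add: p_def)
  have n: "n = p + Suc q"
    using Suc.prems(3) l_Suc by (simp add: q_def)
  have L: "l ` {1..k} \<subseteq> {1..p}"
  proof
    fix m assume "m \<in> l ` {1..k}"
    then obtain i where i: "m = l i" "1 \<le> i" "i \<le> k"
      by auto
    then have "l 1 \<le> l i" "l i < l (Suc k)"
      using less[of 1 i] less[of i "Suc k"] by (cases "i = 1"; simp)+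
    then show "m \<in> {1..p}"
      using i Suc.prems(2) l_Suc by simp
  qed
  have "strict_mono_on {1..k} l"
    using less by (auto simp: strict_mono_on_def)
  then have IH: "real (card (wipfs_with_lucky p (l ` {1..k}))) =
      (\<Prod>j=1..<k. catalan (l (j + 1) - l j - 1)) * catalan (p - l k)"
    using Suc.IH Suc.prems(2) l_k by blast
  have "p - l k = l (k + 1) - l k - 1"
    using l_Suc by simp
  then have prod: "(\<Prod>j=1..<Suc k. catalan (l (j + 1) - l j - 1)) =
      (\<Prod>j=1..<k. catalan (l (j + 1) - l j - 1)) * catalan (p - l k)"
    using Suc.hyps by (simp add: prod.atLeastLessThan_Suc)
  have "l ` {1..Suc k} = insert (Suc p) (l ` {1..k})"
    using l_Suc by (simp add: atLeastAtMostSuc_conv)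
  then have "card (wipfs_with_lucky n (l ` {1..Suc k})) =
      card (wipfs_with_lucky p (l ` {1..k})) * card (weakly_increasing_pfs q)"
    using card_cut_at_last_lucky[OF L] n by simp
  then show ?case
    by (simp only: of_nat_mult IH card_wipf prod q_def)
qed

theorem lemma2p10:
  fixes n k :: nat and l x :: "nat \<Rightarrow> nat" and L :: "nat set"
  assumes "n \<ge> 1"
    and "L \<subseteq> {1..n}"
    and "L = l ` {1..k}"
    and "strict_mono_on {1..k} l"
    and "\<And>j. 1 \<le> j \<Longrightarrow> j < k \<Longrightarrow> x j = l (j + 1) - l j - 1"
    and "x k = n - l k"
  shows "measure_pmf.prob (pmf_of_set (weakly_increasing_pfs n)) {\<alpha>. lucky_cars \<alpha> = L} =
           (if 1 \<notin> L then 0 else (\<Prod>j=1..k. catalan (x j)) / catalan n)"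
proof -
  have "replicate n 1 \<in> weakly_increasing_pfs n"
    by (simp add: wipf_iff)
  then have "weakly_increasing_pfs n \<noteq> {}"
    by blast
  moreover have "weakly_increasing_pfs n \<inter> {\<alpha>. lucky_cars \<alpha> = L} = wipfs_with_lucky n L"
    by (auto simp: wipfs_with_lucky_def)
  ultimately have prob: "measure_pmf.prob (pmf_of_set (weakly_increasing_pfs n))
      {\<alpha>. lucky_cars \<alpha> = L} = real (card (wipfs_with_lucky n L)) / catalan n"
    by (simp add: measure_pmf_of_set finite_wipf card_wipf)
  show ?thesis
  proof (cases "1 \<in> L")
    case False
    then have "wipfs_with_lucky n L = {}"
      using first_car_lucky assms(1) by (auto simp: wipfs_with_lucky_def)
    then show ?thesis
      using False prob by simp
  next
    case True
    then obtain i where i: "1 \<le> i" "i \<le> k" "l i = 1"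
      using assms(3) by auto
    then have k: "1 \<le> k"
      by simp
    have "l 1 \<in> L" "l k \<in> L"
      using assms(3) k by auto
    then have bounds: "1 \<le> l 1" "l k \<le> n"
      using assms(2) by auto
    have "i = 1"
    proof (rule ccontr)
      assume "i \<noteq> 1"
      then have "l 1 < l i"
        using strict_mono_onD[OF assms(4), of 1 i] i by simp
      then show False
        using i bounds by simp
    qed
    then have l1: "l 1 = 1"
      using i by simp
    have "{1..k} = insert k {1..<k}"
      using k by auto
    then have "(\<Prod>j=1..k. catalan (x j)) = (\<Prod>j=1..<k. catalan (x j)) * catalan (x k)"
      by simp
    also have "\<dots> = (\<Prod>j=1..<k. catalan (l (j + 1) - l j - 1)) * catalan (n - l k)"
      unfolding assms(6) by (intro arg_cong2[where f = "(*)"] prod.cong) (simp_all add: assms(5))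
    also have "\<dots> = real (card (wipfs_with_lucky n L))"
      using card_wipfs_with_lucky[OF k assms(4) l1 bounds(2)] assms(3) by simp
    finally show ?thesis
      using True prob by simp
  qed
qed

end
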